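(* Let $\mathfrak{g}$ be a real three-dimensional Lie algebra, and endow $\mathfrak{g}^*$ with its Lie--Poisson structure. Then $\mathfrak{g}^*$ admits a homogeneous Hamiltonian with a nontrivial conformal relative equilibrium if and only if $\mathfrak{g}$ is of Bianchi type III, IV, V, VI$_{-1}$, VI$_h$ ($h\neq0,-1$), VII$_h$ ($|h|\ge2$), or VIII. Equivalently, no such Hamiltonian exists precisely for types I, II, VII$_0$, IX, and VII$_h$ with $0<|h|<2$.
   Context: Bianchi types (Ellis--MacCallum convention as used in the paper): $\mathfrak{g}$ is of a given type if it has a basis $(e_1,e_2,e_3)$ whose brackets are $[e_i,e_j]=\sum_k C^k{}_{ij}e_k$, with $C^i{}_{jk}=\sum_s\varepsilon_{jks}m^{si}+\delta^i_ka_j-\delta^i_ja_k$ for the symmetric matrix $m$ and vector $a$ of that type. Explicitly (brackets not determined by those listed by antisymmetry are zero): I: abelian. II: $[e_2,e_3]=e_1$. III: $[e_1,e_3]=e_1$. IV: $[e_1,e_3]=e_1$, $[e_2,e_3]=e_1+e_2$. V: $[e_1,e_3]=e_1$, $[e_2,e_3]=e_2$. VI$_{-1}$: $[e_1,e_3]=e_1$, $[e_2,e_3]=-e_2$. VI$_h$ ($h\in\mathbb{R}$, $h\ne0,-1$): $[e_1,e_3]=e_1$, $[e_2,e_3]=h\,e_2$. VII$_0$: $[e_1,e_3]=e_2$, $[e_2,e_3]=-e_1$. VII$_h$ ($h\in\mathbb{R}$, $h\neq0$): $[e_1,e_3]=e_2$, $[e_2,e_3]=-e_1+h\,e_2$.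 VIII: $[e_1,e_2]=e_3$, $[e_1,e_3]=-e_2$, $[e_2,e_3]=-e_1$ (isomorphic to $\mathfrak{so}(2,1)$). IX: $[e_1,e_2]=e_3$, $[e_1,e_3]=-e_2$, $[e_2,e_3]=e_1$ (isomorphic to $\mathfrak{so}(3)$). By the classical Bianchi classification every real three-dimensional Lie algebra is isomorphic to one in this list (in this parametrization some of the listed algebras are isomorphic to each other). For $\zeta\in\mathfrak{g}$, $\mathrm{ad}^*_\zeta:\mathfrak{g}^*\to\mathfrak{g}^*$ is defined by $\langle\mathrm{ad}^*_\zeta\mu,\eta\rangle=-\langle\mu,[\zeta,\eta]\rangle$. The Lie--Poisson bracket on $\mathfrak{g}^*$ is $\{f,g\}(\mu)=\langle\mu,[df(\mu),dg(\mu)]\rangle$ and the Hamiltonian vector field of $H\in C^\infty(\mathfrak{g}^* )$ is $X_H(\mu)=\mathrm{ad}^*_{dH(\mu)}\mu$, with $dH(\mu)\in T_\mu^*\mathfrak{g}^*\cong\mathfrak{g}$. $H$ is homogeneous (of degree $b\in\mathbb{R}$) if $H(s\mu)=s^bH(\mu)$ for all $s>0$ and $\mu\in\mathfrak{g}^*$. A nontrivial conformal relative equilibrium for $H$ (with respect to the scaling action $\Phi_s(\mu)=s\mu$) is a point $\mu_e\in\mathfrak{g}^*$, $\mu_e\neq0$, such that $X_H(\mu_e)=\xi\,\mu_e$ for some real $\xi\neq0$. *)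

theory Defs
  imports "HOL-Analysis.Analysis"
begin

text \<open>
  A finite-dimensional real Lie algebra is carried by a type of class \<^class>\<open>euclidean_space\<close>.
  The inner product is used only for the (unique) vector space topology; the bracket is unrelated to it.
  The dual space is the type of bounded linear functionals; in finite dimension these
  are all linear functionals.
\<close>

locale real_lie_algebra =
  fixes br :: "'a::euclidean_space \<Rightarrow> 'a \<Rightarrow> 'a"
  assumes bilinear_br: "bilinear br"
    and br_self: "br x x = 0"
    and jacobi: "br x (br y z) + br y (br z x) + br z (br x y) = 0"

type_synonym 'a dual = "'a \<Rightarrow>\<^sub>L real"

text \<open>
  \<open>C\<^sup>k\<close> and \<open>C\<^sup>\<infinity>\<close> functions through iterated directional derivatives. On a
  finite-dimensional domain, which is the only case used here, this is the usual notion.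
\<close>

fun C_k :: "nat \<Rightarrow> ('b::real_normed_vector \<Rightarrow> real) \<Rightarrow> bool" where
  "C_k 0 f \<longleftrightarrow> continuous_on UNIV f"
| "C_k (Suc k) f \<longleftrightarrow> (\<forall>x. f differentiable (at x)) \<and>
     (\<forall>v. C_k k (\<lambda>x. frechet_derivative f (at x) v))"

definition smooth :: "('b::real_normed_vector \<Rightarrow> real) \<Rightarrow> bool" where
  "smooth f \<longleftrightarrow> (\<forall>k. C_k k f)"

text \<open>
  The differential of a function on the dual, as an element of the Lie algebra itself
  under the canonical identification of the bidual with the original space.
\<close>

definition differential :: "('a::euclidean_space dual \<Rightarrow> real) \<Rightarrow> 'a dual \<Rightarrow> 'a" where
  "differential f \<mu> =
     (THE \<zeta>. (f has_derivative (\<lambda>\<nu>. blinfun_apply \<nu> \<zeta>)) (at \<mu>))"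

lemma differential_eqI:
  fixes f :: "'a::euclidean_space dual \<Rightarrow> real"
  assumes "(f has_derivative (\<lambda>\<nu>. blinfun_apply \<nu> \<zeta>)) (at \<mu>)"
  shows "differential f \<mu> = \<zeta>"
  unfolding differential_def
proof (rule the_equality)
  fix \<eta>
  assume \<eta>: "(f has_derivative (\<lambda>\<nu>. blinfun_apply \<nu> \<eta>)) (at \<mu>)"
  have dir: "((\<lambda>t. f (\<mu> + t *\<^sub>R \<nu>)) has_real_derivative blinfun_apply \<nu> \<xi>) (at 0)"
    if "(f has_derivative (\<lambda>\<nu>. blinfun_apply \<nu> \<xi>)) (at \<mu>)" for \<nu> \<xi>
  proof -
    have "((\<lambda>t. \<mu> + t *\<^sub>R \<nu>) has_derivative (\<lambda>t. t *\<^sub>R \<nu>)) (at (0::real))"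
      by (auto intro!: derivative_eq_intros)
    moreover have "(f has_derivative (\<lambda>\<nu>. blinfun_apply \<nu> \<xi>)) (at (\<mu> + 0 *\<^sub>R \<nu>))"
      using that by simp
    ultimately have "((\<lambda>t. f (\<mu> + t *\<^sub>R \<nu>)) has_derivative (\<lambda>t. blinfun_apply (t *\<^sub>R \<nu>) \<xi>)) (at 0)"
      by (rule has_derivative_compose)
    then show ?thesis
      by (simp add: has_field_derivative_def blinfun.scaleR_left mult_commute_abs)
  qed
  have eq: "blinfun_apply \<nu> \<eta> = blinfun_apply \<nu> \<zeta>" for \<nu> :: "'a dual"
    by (rule DERIV_unique[OF dir[OF \<eta>] dir[OF assms]])
  show "\<eta> = \<zeta>"
  proof (rule euclidean_eqI)
    fix b :: 'a
    show "\<eta> \<bullet> b = \<zeta> \<bullet> b"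
      using eq[of "blinfun_inner_left b"] by (simp add: inner_commute)
  qed
qed (fact assms)

lemma differential_works:
  fixes f :: "'a::euclidean_space dual \<Rightarrow> real"
  assumes "f differentiable (at \<mu>)"
  shows "(f has_derivative (\<lambda>\<nu>. blinfun_apply \<nu> (differential f \<mu>))) (at \<mu>)"
proof -
  obtain D where D: "(f has_derivative D) (at \<mu>)"
    using assms by (auto simp: differentiable_def)
  then interpret D: bounded_linear D by (rule has_derivative_bounded_linear)
  define \<zeta> where "\<zeta> = (\<Sum>b\<in>Basis. D (blinfun_inner_left b) *\<^sub>R b)"
  have "D \<nu> = blinfun_apply \<nu> \<zeta>" for \<nu>
  proof -
    have "\<nu> = (\<Sum>b\<in>Basis. blinfun_apply \<nu> b *\<^sub>R blinfun_inner_left b)"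
    proof (rule blinfun_eqI)
      fix x :: 'a
      have "blinfun_apply \<nu> x = blinfun_apply \<nu> (\<Sum>b\<in>Basis. (x \<bullet> b) *\<^sub>R b)"
        by (simp add: euclidean_representation)
      also have "\<dots> = (\<Sum>b\<in>Basis. blinfun_apply \<nu> b * (x \<bullet> b))"
        by (simp add: blinfun.sum_right blinfun.scaleR_right mult.commute)
      finally show "blinfun_apply \<nu> x =
          blinfun_apply (\<Sum>b\<in>Basis. blinfun_apply \<nu> b *\<^sub>R blinfun_inner_left b) x"
        by (simp add: blinfun.sum_left blinfun.scaleR_left inner_commute)
    qed
    then have "D \<nu> = D (\<Sum>b\<in>Basis. blinfun_apply \<nu> b *\<^sub>R blinfun_inner_left b)"
      by simp
    then show ?thesis
      by (simp add: \<zeta>_def D.sum D.scaleR blinfun.sum_right blinfun.scaleR_right mult.commute)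
  qed
  then have "D = (\<lambda>\<nu>. blinfun_apply \<nu> \<zeta>)" by auto
  with D have f: "(f has_derivative (\<lambda>\<nu>. blinfun_apply \<nu> \<zeta>)) (at \<mu>)"
    by (simp only:)
  then show ?thesis
    by (simp only: differential_eqI[OF f])
qed

definition coad :: "('a::euclidean_space \<Rightarrow> 'a \<Rightarrow> 'a) \<Rightarrow> 'a \<Rightarrow> 'a dual \<Rightarrow> 'a dual" where
  "coad br \<zeta> \<mu> = Blinfun (\<lambda>\<eta>. - blinfun_apply \<mu> (br \<zeta> \<eta>))"

lemma (in real_lie_algebra) coad_apply:
  "blinfun_apply (coad br \<zeta> \<mu>) \<eta> = - blinfun_apply \<mu> (br \<zeta> \<eta>)"
proof -
  have "linear (\<lambda>\<eta>. - blinfun_apply \<mu> (br \<zeta> \<eta>))"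
    by (rule linearI)
      (simp_all add: bilinear_radd[OF bilinear_br] bilinear_rmul[OF bilinear_br]
        blinfun.add_right blinfun.scaleR_right)
  then show ?thesis
    by (simp add: coad_def bounded_linear_Blinfun_apply linear_conv_bounded_linear)
qed

definition lie_poisson ::
  "('a::euclidean_space \<Rightarrow> 'a \<Rightarrow> 'a) \<Rightarrow> ('a dual \<Rightarrow> real) \<Rightarrow> ('a dual \<Rightarrow> real) \<Rightarrow> 'a dual \<Rightarrow> real" where
  "lie_poisson br f g \<mu> = blinfun_apply \<mu> (br (differential f \<mu>) (differential g \<mu>))"

definition hamiltonian_vf ::
  "('a::euclidean_space \<Rightarrow> 'a \<Rightarrow> 'a) \<Rightarrow> ('a dual \<Rightarrow> real) \<Rightarrow> 'a dual \<Rightarrow> 'a dual" where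
  "hamiltonian_vf br H \<mu> = coad br (differential H \<mu>) \<mu>"

text \<open>The Hamiltonian vector field of \<open>H\<close> is the derivation \<open>{_, H}\<close> of the Lie--Poisson bracket.\<close>

lemma (in real_lie_algebra) hamiltonian_vf_lie_poisson:
  "blinfun_apply (hamiltonian_vf br H \<mu>) (differential f \<mu>) = lie_poisson br f H \<mu>"
proof -
  define x where "x = differential H \<mu>"
  define y where "y = differential f \<mu>"
  have "br (x + y) (x + y) = br x x + br x y + (br y x + br y y)"
    by (simp only: bilinear_ladd[OF bilinear_br] bilinear_radd[OF bilinear_br] add_ac)
  then have "br y x = - br x y"
    by (simp add: br_self eq_neg_iff_add_eq_0 add.commute)
  then have "blinfun_apply \<mu> (br y x) = - blinfun_apply \<mu> (br x y)"
    by (simp add: blinfun.minus_right)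
  then show ?thesis
    by (simp add: hamiltonian_vf_def coad_apply lie_poisson_def x_def y_def)
qed

definition homogeneous :: "('b::real_vector \<Rightarrow> real) \<Rightarrow> bool" where
  "homogeneous H \<longleftrightarrow> (\<exists>b::real. \<forall>s>0. \<forall>\<mu>. H (s *\<^sub>R \<mu>) = s powr b * H \<mu>)"

definition nontrivial_conformal_relative_equilibrium ::
  "('a::euclidean_space \<Rightarrow> 'a \<Rightarrow> 'a) \<Rightarrow> ('a dual \<Rightarrow> real) \<Rightarrow> 'a dual \<Rightarrow> bool" where
  "nontrivial_conformal_relative_equilibrium br H \<mu> \<longleftrightarrow>
     \<mu> \<noteq> 0 \<and> (\<exists>\<xi>::real. \<xi> \<noteq> 0 \<and> hamiltonian_vf br H \<mu> = \<xi> *\<^sub>R \<mu>)"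

text \<open>
  The types \<open>VI\<^sub>h\<close> and \<open>VII\<^sub>h\<close> each have one constructor for all \<open>h\<close>; thus \<open>VI\<^sub>-\<^sub>1\<close> is
  \<open>Bianchi_VI (-1)\<close> and \<open>VII\<^sub>0\<close> is \<open>Bianchi_VII 0\<close>. In \<open>VII\<^sub>h\<close> the parameter \<open>h\<close> is
  the trace of \<open>[_, e\<^sub>3]\<close> on the span of \<open>e\<^sub>1, e\<^sub>2\<close>, not a quotient of invariants
  as in some other conventions.
\<close>

datatype bianchi =
    Bianchi_I | Bianchi_II | Bianchi_III | Bianchi_IV | Bianchi_V
  | Bianchi_VI real | Bianchi_VII real | Bianchi_VIII | Bianchi_IX

text \<open>The triple of brackets \<open>([e\<^sub>1, e\<^sub>2], [e\<^sub>1, e\<^sub>3], [e\<^sub>2, e\<^sub>3])\<close> of each type.\<close>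

fun bianchi_brackets :: "bianchi \<Rightarrow> 'a::real_vector \<Rightarrow> 'a \<Rightarrow> 'a \<Rightarrow> 'a \<times> 'a \<times> 'a" where
  "bianchi_brackets Bianchi_I e1 e2 e3 = (0, 0, 0)"
| "bianchi_brackets Bianchi_II e1 e2 e3 = (0, 0, e1)"
| "bianchi_brackets Bianchi_III e1 e2 e3 = (0, e1, 0)"
| "bianchi_brackets Bianchi_IV e1 e2 e3 = (0, e1, e1 + e2)"
| "bianchi_brackets Bianchi_V e1 e2 e3 = (0, e1, e2)"
| "bianchi_brackets (Bianchi_VI h) e1 e2 e3 = (0, e1, h *\<^sub>R e2)"
| "bianchi_brackets (Bianchi_VII h) e1 e2 e3 = (0, e2, - e1 + h *\<^sub>R e2)"
| "bianchi_brackets Bianchi_VIII e1 e2 e3 = (e3, - e2, - e1)"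
| "bianchi_brackets Bianchi_IX e1 e2 e3 = (e3, - e2, e1)"

definition of_bianchi_type ::
  "('a::euclidean_space \<Rightarrow> 'a \<Rightarrow> 'a) \<Rightarrow> bianchi \<Rightarrow> bool" where
  "of_bianchi_type br T \<longleftrightarrow>
     (\<exists>e1 e2 e3. distinct [e1, e2, e3] \<and> independent {e1, e2, e3} \<and> span {e1, e2, e3} = UNIV \<and>
        (br e1 e2, br e1 e3, br e2 e3) = bianchi_brackets T e1 e2 e3)"

end

theory Submission
  imports Defs
begin

text \<open>
  At an equilibrium \<open>\<mu>\<close>, put \<open>\<zeta> = dH(\<mu>)\<close>: then \<open>\<mu>\<close> is an eigenvector of \<open>ad\<^sup>*\<^sub>\<zeta>\<close>
  with nonzero real eigenvalue, and conversely such an eigenvector is an equilibrium of the linear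
  Hamiltonian \<open>\<mu> \<mapsto> \<langle>\<mu>, \<zeta>\<rangle>\<close>. Since \<open>ad\<^sub>\<zeta>\<close> and its transpose have the same
  eigenvalues, equilibria exist iff \<open>[x, y] = c y\<close> for some \<open>x\<close>, \<open>y \<noteq> 0\<close>, \<open>c \<noteq> 0\<close>.

  If this holds, the Jacobi identity in a basis containing \<open>x\<close> and \<open>y\<close> leaves only the types III--VI
  and VIII. If it fails and some \<open>ad\<^sub>x\<close> is not nilpotent, then \<open>ad\<^sub>x\<close> has a pair of nonreal
  eigenvalues; the bracket of two vectors spanning its image lies in the kernel of
  \<open>ad\<^sub>x - tr ad\<^sub>x\<close>, so it vanishes (type VII with \<open>|h| < 2\<close>), or the trace is zero and it is
  a nonzero multiple of \<open>x\<close> (type IX). If every \<open>ad\<^sub>x\<close> is nilpotent, then in fact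
  \<open>ad\<^sub>x \<circ> ad\<^sub>x = 0\<close> for all \<open>x\<close>, which gives types I and II.
\<close>

section \<open>Linear independence and coordinates for triples of vectors\<close>

definition lin_indep3 :: "'a::real_vector \<Rightarrow> 'a \<Rightarrow> 'a \<Rightarrow> bool" where
  "lin_indep3 x y z \<longleftrightarrow>
     (\<forall>a b c. a *\<^sub>R x + b *\<^sub>R y + c *\<^sub>R z = 0 \<longrightarrow> a = 0 \<and> b = 0 \<and> c = 0)"

lemma lin_indep3D:
  assumes "lin_indep3 x y z" "a *\<^sub>R x + b *\<^sub>R y + c *\<^sub>R z = 0"
  shows "a = 0" "b = 0" "c = 0"
  using assms by (auto simp: lin_indep3_def)

lemma lin_indep3_eqD:
  assumes "lin_indep3 x y z"
    and "a *\<^sub>R x + b *\<^sub>R y + c *\<^sub>R z = a' *\<^sub>R x + b' *\<^sub>R y + c' *\<^sub>R z"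
  shows "a = a'" "b = b'" "c = c'"
proof -
  have "(a - a') *\<^sub>R x + (b - b') *\<^sub>R y + (c - c') *\<^sub>R z = 0"
    using assms(2) by (simp add: algebra_simps)
  from lin_indep3D[OF assms(1) this] show "a = a'" "b = b'" "c = c'" by auto
qed

lemma lin_indep3_nonzero:
  assumes "lin_indep3 x y z"
  shows "x \<noteq> 0" "y \<noteq> 0" "z \<noteq> 0"
  using lin_indep3D[OF assms, of 1 0 0] lin_indep3D[OF assms, of 0 1 0]
    lin_indep3D[OF assms, of 0 0 1] by auto

text \<open>The coefficient form suits comparison of coordinates; this ties it to the library
  notions in \<open>of_bianchi_type\<close>. Distinctness has to be stated because a repeated vector
  would collapse in the set.\<close>

lemma lin_indep3_iff: "lin_indep3 x y z \<longleftrightarrow> distinct [x, y, z] \<and> independent {x, y, z}"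
proof
  assume L: "lin_indep3 x y z"
  note D = lin_indep3D[OF L]
  have "x \<noteq> y" using D[of 1 "- 1" 0] by auto
  moreover have "x \<noteq> z" using D[of 1 0 "- 1"] by auto
  moreover have "y \<noteq> z" using D[of 0 1 "- 1"] by auto
  moreover have "y \<notin> span {z}"
  proof
    assume "y \<in> span {z}"
    then obtain k where "y = k *\<^sub>R z" by (auto simp: span_singleton)
    then show False using D(2)[of 0 1 "- k"] by simp
  qed
  moreover have "x \<notin> span {y, z}"
  proof
    assume "x \<in> span {y, z}"
    then obtain j k where "x - j *\<^sub>R y = k *\<^sub>R z" by (auto simp: span_insert span_singleton)
    then show False using D(1)[of 1 "- j" "- k"] by (simp add: algebra_simps)
  qed
  ultimately show "distinct [x, y, z] \<and> independent {x, y, z}"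
    using lin_indep3_nonzero[OF L] by (simp add: independent_insert)
next
  assume I: "distinct [x, y, z] \<and> independent {x, y, z}"
  show "lin_indep3 x y z"
    unfolding lin_indep3_def
  proof (intro allI impI)
    fix a b c
    assume e: "a *\<^sub>R x + b *\<^sub>R y + c *\<^sub>R z = 0"
    define u where "u v = (if v = x then a else if v = y then b else c)" for v
    have s: "(\<Sum>v\<in>{x, y, z}. u v *\<^sub>R v) = 0"
      using e I by (simp add: u_def add.assoc) (auto simp: algebra_simps)
    have "u v = 0" if "v \<in> {x, y, z}" for v
      using I independentD[of "{x, y, z}" "{x, y, z}" u v] s that by blast
    from this[of x] this[of y] this[of z] show "a = 0 \<and> b = 0 \<and> c = 0"
      using I by (auto simp: u_def)
  qed
qed

lemma lin_indep3_span:
  fixes x y z :: "'a::euclidean_space"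
  assumes "DIM('a) = 3" "lin_indep3 x y z"
  shows "span {x, y, z} = UNIV"
proof -
  have "card {x, y, z} = 3" "independent {x, y, z}"
    using assms(2) by (auto simp: lin_indep3_iff)
  then show ?thesis
    using card_ge_dim_independent[of "{x, y, z}" UNIV] assms(1) by auto
qed

lemma lin_indep3_coords:
  fixes x y z :: "'a::euclidean_space"
  assumes "DIM('a) = 3" "lin_indep3 x y z"
  obtains a b c where "w = a *\<^sub>R x + b *\<^sub>R y + c *\<^sub>R z"
proof -
  have "w \<in> span {x, y, z}" using lin_indep3_span[OF assms] by simp
  then obtain a b c where "w - a *\<^sub>R x - b *\<^sub>R y = c *\<^sub>R z"
    by (auto simp: span_insert span_singleton)
  then have "w = a *\<^sub>R x + b *\<^sub>R y + c *\<^sub>R z" by (simp add: algebra_simps)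
  then show ?thesis by (rule that)
qed

text \<open>Two vectors span at most a plane, so in dimension 3 some vector lies outside their span,
  and any such vector completes the triple.\<close>

lemma lin_indep3_extend:
  fixes x y :: "'a::euclidean_space"
  assumes "DIM('a) = 3"
    and "\<And>a b. a *\<^sub>R x + b *\<^sub>R y = 0 \<Longrightarrow> a = 0 \<and> b = 0"
  obtains z where "lin_indep3 x y z"
proof -
  have "dim (span {x, y}) \<le> card {x, y}" by (simp add: dim_le_card')
  also have "\<dots> \<le> 2" by (simp add: card_insert_if)
  finally have "span {x, y} \<noteq> UNIV" using assms(1) dim_UNIV[where ?'a = 'a] by force
  then obtain z where z: "z \<notin> span {x, y}" by auto
  have "lin_indep3 x y z"
    unfolding lin_indep3_def
  proof (intro allI impI)
    fix a b c
    assume e: "a *\<^sub>R x + b *\<^sub>R y + c *\<^sub>R z = 0"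
    have "c = 0"
    proof (rule ccontr)
      assume "c \<noteq> 0"
      have "c *\<^sub>R z = (- a) *\<^sub>R x + (- b) *\<^sub>R y"
        using e by (simp add: algebra_simps eq_neg_iff_add_eq_0)
      then have "c *\<^sub>R z \<in> span {x, y}"
        by (simp add: span_add span_base span_scale span_neg span_diff)
      then have "(1 / c) *\<^sub>R (c *\<^sub>R z) \<in> span {x, y}" by (rule span_scale)
      with z \<open>c \<noteq> 0\<close> show False by simp
    qed
    with e assms(2)[of a b] show "a = 0 \<and> b = 0 \<and> c = 0" by simp
  qed
  then show ?thesis by (rule that)
qed

lemma of_bianchi_type_iff:
  fixes br :: "'a::euclidean_space \<Rightarrow> 'a \<Rightarrow> 'a"
  assumes "DIM('a) = 3"
  shows "of_bianchi_type br T \<longleftrightarrow>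
    (\<exists>e1 e2 e3. lin_indep3 e1 e2 e3 \<and> (br e1 e2, br e1 e3, br e2 e3) = bianchi_brackets T e1 e2 e3)"
  unfolding of_bianchi_type_def
  using lin_indep3_span[OF assms] lin_indep3_iff by metis

section \<open>Smoothness of linear Hamiltonians and the eigenvalue criterion\<close>

lemma C_k_const: "C_k k (\<lambda>_. c)"
  by (induction k arbitrary: c) auto

text \<open>The derivative of \<open>f\<close> at every point is \<open>f\<close> itself, so each
  directional derivative is a constant function.\<close>

lemma smooth_bounded_linear:
  assumes "bounded_linear f"
  shows "smooth f"
proof -
  have "C_k k f" for k
  proof (cases k)
    case 0
    then show ?thesis using linear_continuous_on[OF assms] by simp
  next
    case (Suc n)
    have "frechet_derivative f (at x) = f" for x
      using frechet_derivative_at[OF bounded_linear_imp_has_derivative[OF assms]] by metis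
    then show ?thesis
      using Suc bounded_linear_imp_differentiable[OF assms] by (simp add: C_k_const)
  qed
  then show ?thesis by (simp add: smooth_def)
qed

definition ad_eigenpair :: "('a::real_vector \<Rightarrow> 'a \<Rightarrow> 'a) \<Rightarrow> bool" where
  "ad_eigenpair br \<longleftrightarrow> (\<exists>x y c. c \<noteq> (0::real) \<and> y \<noteq> 0 \<and> br x y = c *\<^sub>R y)"

context real_lie_algebra
begin

lemmas br_linear =
  bilinear_ladd[OF bilinear_br] bilinear_radd[OF bilinear_br]
  bilinear_lmul[OF bilinear_br] bilinear_rmul[OF bilinear_br]
  bilinear_lneg[OF bilinear_br] bilinear_rneg[OF bilinear_br]
  bilinear_lsub[OF bilinear_br] bilinear_rsub[OF bilinear_br]
  bilinear_lzero[OF bilinear_br] bilinear_rzero[OF bilinear_br] br_self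

lemma br_anti: "br y x = - br x y"
proof -
  have "br (x + y) (x + y) = br x x + br x y + (br y x + br y y)"
    by (simp only: bilinear_ladd[OF bilinear_br] bilinear_radd[OF bilinear_br] add_ac)
  then show ?thesis
    by (simp add: br_self eq_neg_iff_add_eq_0 add.commute)
qed

lemma br_derivation: "br x (br y z) = br (br x y) z + br y (br x z)"
proof -
  have "br y (br z x) = - br y (br x z)"
    unfolding br_anti[of z x] by (rule bilinear_rneg[OF bilinear_br])
  moreover have "br z (br x y) = - br (br x y) z" by (rule br_anti)
  ultimately show ?thesis using jacobi[of x y z] by (simp only:) (simp add: algebra_simps)
qed

lemma linear_shifted_ad: "linear (\<lambda>y. br x y - c *\<^sub>R y)"
  by (rule linearI) (simp_all add: br_linear algebra_simps)

lemma equilibrium_iff_ad_eigenpair: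
  "(\<exists>H. smooth H \<and> homogeneous H \<and> (\<exists>\<mu>. nontrivial_conformal_relative_equilibrium br H \<mu>))
     \<longleftrightarrow> ad_eigenpair br"
proof
  assume "\<exists>H. smooth H \<and> homogeneous H \<and> (\<exists>\<mu>. nontrivial_conformal_relative_equilibrium br H \<mu>)"
  then obtain x \<mu> c where \<mu>: "\<mu> \<noteq> 0" and c: "c \<noteq> 0" and eq: "coad br x \<mu> = c *\<^sub>R \<mu>"
    by (auto simp: nontrivial_conformal_relative_equilibrium_def hamiltonian_vf_def)
  \<comment> \<open>The covector \<open>\<mu>\<close> annihilates the image of ad_x +
    \<open>c\<close>. In finite dimension a proper image forces a nonzero kernel, whose vectors are
    eigenvectors of ad_x for \<open>- c\<close>.\<close>
  have 0: "blinfun_apply \<mu> (br x y - (- c) *\<^sub>R y) = 0" for y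
    using coad_apply[of x \<mu> y] eq by (simp add: blinfun.add_right blinfun.scaleR_right scaleR_blinfun.rep_eq)
  have "\<not> surj (\<lambda>y. br x y - (- c) *\<^sub>R y)"
  proof
    assume s: "surj (\<lambda>y. br x y - (- c) *\<^sub>R y)"
    have "blinfun_apply \<mu> z = 0" for z
    proof -
      obtain y where "z = br x y - (- c) *\<^sub>R y" using surjD[OF s] by blast
      then show ?thesis by (simp only: 0)
    qed
    then have "\<mu> = 0" by (intro blinfun_eqI) simp
    with \<mu> show False ..
  qed
  then have "\<not> inj (\<lambda>y. br x y - (- c) *\<^sub>R y)"
    using linear_injective_imp_surjective[OF linear_shifted_ad] by blast
  then obtain y where "y \<noteq> 0" and "br x y - (- c) *\<^sub>R y = 0"
    unfolding linear_injective_0[OF linear_shifted_ad] by blast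
  then have "br x y = (- c) *\<^sub>R y" by (simp only: right_minus_eq)
  then show "ad_eigenpair br"
    using c \<open>y \<noteq> 0\<close> unfolding ad_eigenpair_def by (intro exI[of _ x] exI[of _ y] exI[of _ "- c"]) simp
next
  assume "ad_eigenpair br"
  then obtain x y c where c: "c \<noteq> 0" and y: "y \<noteq> 0" "br x y = c *\<^sub>R y"
    by (auto simp: ad_eigenpair_def)
  define f where "f = (\<lambda>y. br x y - c *\<^sub>R y)"
  have f: "linear f" unfolding f_def by (rule linear_shifted_ad)
  have "\<not> inj f" unfolding linear_injective_0[OF f] using y by (auto simp: f_def)
  then have "\<not> surj f" using linear_surjective_imp_injective[OF f] by blast
  \<comment> \<open>The image of ad_x - \<open>c\<close> is a proper subspace; the inner product
    with a nonzero vector orthogonal to it is an eigenvector of \<open>coad br x\<close> for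
    \<open>- c\<close>.\<close>
  then have "span (range f) \<noteq> UNIV"
    by (metis linear_subspace_image[OF f] span_eq_iff subspace_UNIV)
  then obtain a where a: "a \<noteq> 0" "\<And>z. a \<bullet> f z = 0"
    using span_not_UNIV_orthogonal[of "range f"] by (metis rangeI span_base)
  define \<mu> where "\<mu> = blinfun_inner_left a"
  \<comment> \<open>A linear Hamiltonian: homogeneous of degree 1, with differential
    \<open>x\<close> at every point.\<close>
  define H where "H = (\<lambda>\<nu> :: 'a dual. blinfun_apply \<nu> x)"
  have bl: "bounded_linear H" unfolding H_def by (rule blinfun.bounded_linear_left)
  have d: "differential H \<mu> = x"
    by (rule differential_eqI, fold H_def) (rule bounded_linear_imp_has_derivative[OF bl])
  have "homogeneous H"
    unfolding homogeneous_def by (rule exI[of _ 1]) (simp add: H_def scaleR_blinfun.rep_eq)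
  moreover have "coad br x \<mu> = (- c) *\<^sub>R \<mu>"
    by (rule blinfun_eqI)
      (use a(2) in \<open>simp add: coad_apply scaleR_blinfun.rep_eq uminus_blinfun.rep_eq \<mu>_def f_def inner_diff_right inner_commute\<close>)
  moreover have "\<mu> \<noteq> 0"
  proof
    assume "\<mu> = 0"
    then have "blinfun_apply \<mu> a = 0" by simp
    then show False using a(1) by (simp add: \<mu>_def)
  qed
  ultimately have "nontrivial_conformal_relative_equilibrium br H \<mu>"
    unfolding nontrivial_conformal_relative_equilibrium_def hamiltonian_vf_def d
    using c by (intro conjI exI[of _ "- c"]) simp_all
  then show "\<exists>H. smooth H \<and> homogeneous H \<and> (\<exists>\<mu>. nontrivial_conformal_relative_equilibrium br H \<mu>)"
    using smooth_bounded_linear[OF bl] \<open>homogeneous H\<close> by blast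
qed

section \<open>Types without an eigenpair: I, II, VII with |h| < 2, and IX\<close>

text \<open>Bilinearity and antisymmetry leave the three 2x2 minors of the coordinate matrix as
  coefficients.\<close>

lemma br_coords:
  "br (a *\<^sub>R x + b *\<^sub>R y + c *\<^sub>R z) (p *\<^sub>R x + q *\<^sub>R y + r *\<^sub>R z) =
     (a * q - b * p) *\<^sub>R br x y + (a * r - c * p) *\<^sub>R br x z + (b * r - c * q) *\<^sub>R br y z"
  by (simp add: br_linear br_anti[of x y] br_anti[of x z] br_anti[of y z] algebra_simps)

text \<open>Reduces the claim to coordinates: \<open>(a, b, c)\<close> are those of the acting
  vector, \<open>(p, q, r)\<close> those of a candidate eigenvector, and \<open>l\<close> is the
  eigenvalue.\<close>

lemma not_ad_eigenpairI:
  assumes "DIM('a) = 3" "lin_indep3 x y z"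
    and "\<And>a b c p q r l. l \<noteq> 0 \<Longrightarrow>
      (a * q - b * p) *\<^sub>R br x y + (a * r - c * p) *\<^sub>R br x z + (b * r - c * q) *\<^sub>R br y z
        = (l * p) *\<^sub>R x + (l * q) *\<^sub>R y + (l * r) *\<^sub>R z \<Longrightarrow> p = 0 \<and> q = 0 \<and> r = 0"
  shows "\<not> ad_eigenpair br"
proof
  assume "ad_eigenpair br"
  then obtain u v l where l: "l \<noteq> 0" "v \<noteq> 0" "br u v = l *\<^sub>R v"
    by (auto simp: ad_eigenpair_def)
  obtain a b c where u: "u = a *\<^sub>R x + b *\<^sub>R y + c *\<^sub>R z"
    by (rule lin_indep3_coords[OF assms(1,2)])
  obtain p q r where v: "v = p *\<^sub>R x + q *\<^sub>R y + r *\<^sub>R z"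
    by (rule lin_indep3_coords[OF assms(1,2)])
  have "p = 0 \<and> q = 0 \<and> r = 0"
    by (rule assms(3)[OF l(1), of a q b p r c])
      (use l(3) in \<open>simp add: u v br_coords scaleR_add_right\<close>)
  with l(2) show False by (simp add: v)
qed

lemma not_ad_eigenpair_I:
  assumes "DIM('a) = 3" "of_bianchi_type br Bianchi_I"
  shows "\<not> ad_eigenpair br"
proof -
  obtain x y z where xyz: "lin_indep3 x y z" and b: "br x y = 0" "br x z = 0" "br y z = 0"
    using assms(2) unfolding of_bianchi_type_iff[OF assms(1)] by auto
  show ?thesis
  proof (rule not_ad_eigenpairI[OF assms(1) xyz])
    fix a b c p q r l :: real
    assume l: "l \<noteq> 0" and e: "(a * q - b * p) *\<^sub>R br x y + (a * r - c * p) *\<^sub>R br x z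
        + (b * r - c * q) *\<^sub>R br y z = (l * p) *\<^sub>R x + (l * q) *\<^sub>R y + (l * r) *\<^sub>R z"
    show "p = 0 \<and> q = 0 \<and> r = 0"
      using lin_indep3D[OF xyz, of "l * p" "l * q" "l * r"] e l by (simp add: b)
  qed
qed

lemma not_ad_eigenpair_II:
  assumes "DIM('a) = 3" "of_bianchi_type br Bianchi_II"
  shows "\<not> ad_eigenpair br"
proof -
  obtain x y z where xyz: "lin_indep3 x y z" and b: "br x y = 0" "br x z = 0" "br y z = x"
    using assms(2) unfolding of_bianchi_type_iff[OF assms(1)] by auto
  show ?thesis
  proof (rule not_ad_eigenpairI[OF assms(1) xyz])
    fix a b c p q r l :: real
    assume l: "l \<noteq> 0" and e: "(a * q - b * p) *\<^sub>R br x y + (a * r - c * p) *\<^sub>R br x z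
        + (b * r - c * q) *\<^sub>R br y z = (l * p) *\<^sub>R x + (l * q) *\<^sub>R y + (l * r) *\<^sub>R z"
    have "(b * r - c * q) *\<^sub>R x + 0 *\<^sub>R y + 0 *\<^sub>R z = (l * p) *\<^sub>R x + (l * q) *\<^sub>R y + (l * r) *\<^sub>R z"
      using e by (simp add: b)
    from lin_indep3_eqD[OF xyz this] show "p = 0 \<and> q = 0 \<and> r = 0"
      using l by auto
  qed
qed

lemma not_ad_eigenpair_VII:
  assumes "DIM('a) = 3" "of_bianchi_type br (Bianchi_VII h)" "\<bar>h\<bar> < 2"
  shows "\<not> ad_eigenpair br"
proof -
  obtain x y z where xyz: "lin_indep3 x y z"
    and b: "br x y = 0" "br x z = y" "br y z = - x + h *\<^sub>R y"
    using assms(2) unfolding of_bianchi_type_iff[OF assms(1)] by auto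
  show ?thesis
  proof (rule not_ad_eigenpairI[OF assms(1) xyz])
    fix a b c p q r l :: real
    assume l: "l \<noteq> 0" and e: "(a * q - b * p) *\<^sub>R br x y + (a * r - c * p) *\<^sub>R br x z
        + (b * r - c * q) *\<^sub>R br y z = (l * p) *\<^sub>R x + (l * q) *\<^sub>R y + (l * r) *\<^sub>R z"
    have "(- (b * r - c * q)) *\<^sub>R x + (a * r - c * p + h * (b * r - c * q)) *\<^sub>R y + 0 *\<^sub>R z
        = (l * p) *\<^sub>R x + (l * q) *\<^sub>R y + (l * r) *\<^sub>R z"
      using e by (simp add: b algebra_simps)
    note E = lin_indep3_eqD[OF xyz this]
    have r: "r = 0" using E(3) l by simp
    have lp: "l * p = c * q" and lq: "l * q = - (c * p) - h * c * q"
      using E(1,2) r by (simp_all add: algebra_simps)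
    \<comment> \<open>Since \<open>r = 0\<close>, the problem lives on the plane of \<open>x\<close>
      and \<open>y\<close>. Eliminating \<open>p\<close> leaves a binary quadratic form in
      \<open>l\<close> and \<open>c\<close> times \<open>q\<close>; its discriminant
      \<open>h\<^sup>2 - 4\<close> is negative, so the form is positive definite.\<close>
    have "l * (l * q) = - (c * (l * p)) - h * c * (l * q)"
      by (subst (2) lq) (simp add: algebra_simps lq)
    then have "(l\<^sup>2 + h * c * l + c\<^sup>2) * q = 0"
      by (simp add: lp algebra_simps power2_eq_square)
    moreover have "l\<^sup>2 + h * c * l + c\<^sup>2 > 0"
    proof -
      have "h\<^sup>2 < 4" using assms(3) abs_square_less_1[of "h / 2"] by (simp add: power_divide)
      have "l\<^sup>2 + h * c * l + c\<^sup>2 = (c + h * l / 2)\<^sup>2 + (1 - h\<^sup>2 / 4) * l\<^sup>2"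
        by (simp add: power2_eq_square algebra_simps)
      also have "\<dots> > 0"
        using \<open>h\<^sup>2 < 4\<close> l by (intro add_nonneg_pos mult_pos_pos) auto
      finally show ?thesis .
    qed
    ultimately have "q = 0" by simp
    with lp l r show "p = 0 \<and> q = 0 \<and> r = 0" by simp
  qed
qed

text \<open>In these coordinates the bracket is the cross product. It is orthogonal to its second
  factor, whereas an eigenvector equation would make it a nonzero multiple of that factor.\<close>

lemma not_ad_eigenpair_IX:
  assumes "DIM('a) = 3" "of_bianchi_type br Bianchi_IX"
  shows "\<not> ad_eigenpair br"
proof -
  obtain x y z where xyz: "lin_indep3 x y z" and b: "br x y = z" "br x z = - y" "br y z = x"
    using assms(2) unfolding of_bianchi_type_iff[OF assms(1)] by auto
  show ?thesis
  proof (rule not_ad_eigenpairI[OF assms(1) xyz])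
    fix a b c p q r l :: real
    assume l: "l \<noteq> 0" and e: "(a * q - b * p) *\<^sub>R br x y + (a * r - c * p) *\<^sub>R br x z
        + (b * r - c * q) *\<^sub>R br y z = (l * p) *\<^sub>R x + (l * q) *\<^sub>R y + (l * r) *\<^sub>R z"
    have "(b * r - c * q) *\<^sub>R x + (- (a * r - c * p)) *\<^sub>R y + (a * q - b * p) *\<^sub>R z
        = (l * p) *\<^sub>R x + (l * q) *\<^sub>R y + (l * r) *\<^sub>R z"
      using e by (simp add: b algebra_simps)
    note E = lin_indep3_eqD[OF xyz this]
    have "l * (p\<^sup>2 + q\<^sup>2 + r\<^sup>2) = (l * p) * p + (l * q) * q + (l * r) * r"
      by (simp add: power2_eq_square algebra_simps)
    also have "\<dots> = 0"
      unfolding E[symmetric] by (simp add: algebra_simps)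
    finally have "p\<^sup>2 + q\<^sup>2 + r\<^sup>2 = 0" using l by simp
    then show "p = 0 \<and> q = 0 \<and> r = 0"
      by (smt (verit) zero_le_power2 power2_eq_iff_nonneg zero_eq_power2)
  qed
qed

section \<open>Types with an eigenpair\<close>

text \<open>Puts the eigenvector in the first slot, as in the normal forms; antisymmetry turns
  \<open>c\<close> into \<open>- c\<close>.\<close>

lemma ad_eigenpairI:
  assumes "br x y = c *\<^sub>R x" "x \<noteq> 0" "c \<noteq> 0"
  shows "ad_eigenpair br"
  unfolding ad_eigenpair_def
  using assms br_anti[of y x] by (intro exI[of _ y] exI[of _ x] exI[of _ "- c"]) simp

text \<open>All these types share the bracket \<open>[e1, e3] = e1\<close>, which already exhibits
  an eigenvector.\<close>

lemma ad_eigenpair_first_bracket: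
  assumes "DIM('a) = 3" "of_bianchi_type br T"
    and "T \<in> {Bianchi_III, Bianchi_IV, Bianchi_V} \<or> (\<exists>h. T = Bianchi_VI h)"
  shows "ad_eigenpair br"
proof -
  obtain x y z where xyz: "lin_indep3 x y z" and "br x z = x"
    using assms(2,3) unfolding of_bianchi_type_iff[OF assms(1)] by auto
  then show ?thesis
    using ad_eigenpairI[of x z 1] lin_indep3_nonzero[OF xyz] by simp
qed

lemma ad_eigenpair_VII:
  assumes "DIM('a) = 3" "of_bianchi_type br (Bianchi_VII h)" "\<bar>h\<bar> \<ge> 2"
  shows "ad_eigenpair br"
proof -
  obtain x y z where xyz: "lin_indep3 x y z" and b: "br x z = y" "br y z = - x + h *\<^sub>R y"
    using assms(2) unfolding of_bianchi_type_iff[OF assms(1)] by auto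
  \<comment> \<open>The larger root of t^2 - h t + 1, the characteristic polynomial of
    \<open>[_, z]\<close> on the plane of \<open>x\<close> and \<open>y\<close>. It is real because
    |h| >= 2, and nonzero because the constant term is 1.\<close>
  define l where "l = (h + sqrt (h\<^sup>2 - 4)) / 2"
  have "h\<^sup>2 \<ge> 4" using assms(3) abs_square_less_1[of "h / 2"] by (simp add: power_divide)
  then have "(sqrt (h\<^sup>2 - 4))\<^sup>2 = h\<^sup>2 - 4" by simp
  then have root: "l * l = h * l - 1"
    unfolding l_def by (simp add: power2_eq_square field_simps)
  then have "l \<noteq> 0" by auto
  define v where "v = (l - h) *\<^sub>R x + y"
  have "br v z = (- 1) *\<^sub>R x + l *\<^sub>R y" by (simp add: v_def br_linear b algebra_simps)
  also have "- 1 = l * (l - h)" using root by (simp add: algebra_simps)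
  also have "(l * (l - h)) *\<^sub>R x + l *\<^sub>R y = l *\<^sub>R v" by (simp add: v_def scaleR_add_right)
  finally have "br v z = l *\<^sub>R v" .
  moreover have "v \<noteq> 0" using lin_indep3D(2)[OF xyz, of "l - h" 1 0] by (auto simp: v_def)
  ultimately show ?thesis using \<open>l \<noteq> 0\<close> by (blast intro: ad_eigenpairI)
qed

lemma ad_eigenpair_VIII:
  assumes "DIM('a) = 3" "of_bianchi_type br Bianchi_VIII"
  shows "ad_eigenpair br"
proof -
  obtain x y z where xyz: "lin_indep3 x y z" and b: "br x y = z" "br y z = - x"
    using assms(2) unfolding of_bianchi_type_iff[OF assms(1)] by auto
  \<comment> \<open>Bracketing with \<open>y\<close> on the right interchanges \<open>x\<close> and
    \<open>z\<close>, so it fixes their sum.\<close>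
  have "br (x + z) y = 1 *\<^sub>R (x + z)" using br_anti[of z y] b by (simp add: br_linear)
  moreover have "x + z \<noteq> 0" using lin_indep3D(1)[OF xyz, of 1 0 1] by auto
  ultimately show ?thesis using ad_eigenpairI[of "x + z" y 1] by simp
qed

section \<open>From an eigenpair to the types III, IV, V, VI and VIII\<close>

text \<open>The map ad_x is a derivation; expanding it on \<open>[y, z]\<close> in two ways and
  comparing the coordinates along \<open>z\<close>, \<open>x\<close> and \<open>y\<close> gives the
  three constraints.\<close>

lemma jacobi_constraints:
  assumes xyz: "lin_indep3 x y z"
    and xy: "br x y = - y"
    and xz: "br x z = \<alpha> *\<^sub>R x + \<beta> *\<^sub>R y + \<gamma> *\<^sub>R z"
    and yz: "br y z = \<delta> *\<^sub>R x + \<epsilon> *\<^sub>R y + \<phi> *\<^sub>R z"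
  shows "\<phi> = 0" "\<delta> = 0 \<or> \<gamma> = 1" "\<alpha> = - \<gamma> * \<epsilon>"
proof -
  have yx: "br y x = y" using xy br_anti[of y x] by simp
  have e: "br x (br y z) = - br y z + br y (br x z)"
    using br_derivation[of x y z] by (simp add: xy br_linear)
  have "(\<phi> * \<alpha>) *\<^sub>R x + (\<phi> * \<beta> - \<epsilon>) *\<^sub>R y + (\<phi> * \<gamma>) *\<^sub>R z = br x (br y z)"
    by (simp add: yz xz xy br_linear algebra_simps)
  also have "\<dots> = ((\<gamma> - 1) * \<delta>) *\<^sub>R x + ((\<gamma> - 1) * \<epsilon> + \<alpha>) *\<^sub>R y + ((\<gamma> - 1) * \<phi>) *\<^sub>R z"
    unfolding e by (simp add: yz xz xy yx br_linear algebra_simps)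
  finally have E: "(\<phi> * \<alpha>) *\<^sub>R x + (\<phi> * \<beta> - \<epsilon>) *\<^sub>R y + (\<phi> * \<gamma>) *\<^sub>R z =
    ((\<gamma> - 1) * \<delta>) *\<^sub>R x + ((\<gamma> - 1) * \<epsilon> + \<alpha>) *\<^sub>R y + ((\<gamma> - 1) * \<phi>) *\<^sub>R z" .
  note E = lin_indep3_eqD[OF xyz E]
  show "\<phi> = 0" using E(3) by (simp add: algebra_simps)
  then show "\<delta> = 0 \<or> \<gamma> = 1" "\<alpha> = - \<gamma> * \<epsilon>" using E(1,2) by (auto simp: algebra_simps)
qed

text \<open>These are the brackets of sl(2,R), with \<open>x\<close> as half of the Cartan element.
  The half sum and half difference of suitably scaled root vectors, together with \<open>x\<close>,
  form the standard so(2,1) basis.\<close>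

lemma of_bianchi_type_VIII:
  assumes "DIM('a) = 3" and xyz: "lin_indep3 x y z" and "\<delta> \<noteq> 0"
    and xy: "br x y = - y" and xz: "br x z = z" and yz: "br y z = \<delta> *\<^sub>R x"
  shows "of_bianchi_type br Bianchi_VIII"
proof -
  \<comment> \<open>The factor normalises the bracket to \<open>[y, w] = 2 x\<close>.\<close>
  define w where "w = (2 / \<delta>) *\<^sub>R z"
  have w: "br x w = w" "br y w = 2 *\<^sub>R x"
    using \<open>\<delta> \<noteq> 0\<close> by (simp_all add: w_def xz yz br_linear)
  have yx: "br y x = y" "br w x = - w" "br w y = - (2 *\<^sub>R x)"
    using xy w br_anti[of y x] br_anti[of w x] br_anti[of w y] by simp_all
  define e1 e3 where "e1 = (1/2) *\<^sub>R (y + w)" and "e3 = (1/2) *\<^sub>R (y - w)"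
  have "lin_indep3 e1 x e3"
    unfolding lin_indep3_def
  proof (intro allI impI)
    fix a b c
    assume "a *\<^sub>R e1 + b *\<^sub>R x + c *\<^sub>R e3 = 0"
    then have "b *\<^sub>R x + ((a + c) / 2) *\<^sub>R y + ((a - c) / \<delta>) *\<^sub>R z = 0"
      by (simp add: e1_def e3_def w_def algebra_simps add_divide_distrib diff_divide_distrib)
    from lin_indep3D[OF xyz this] show "a = 0 \<and> b = 0 \<and> c = 0"
      using \<open>\<delta> \<noteq> 0\<close> by auto
  qed
  moreover have "br e1 x = e3" "br x e3 = - e1"
    by (simp_all add: e1_def e3_def br_linear yx xy w algebra_simps)
  moreover have "br e1 e3 = - x"
  proof -
    have "br e1 e3 = (1/4) *\<^sub>R (- (2 *\<^sub>R x) - 2 *\<^sub>R x)"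
      by (simp add: e1_def e3_def br_linear w yx scaleR_diff_right scaleR_add_right)
    also have "\<dots> = - x" by (simp add: scaleR_diff_right flip: scaleR_add_left scaleR_minus_left scaleR_diff_left)
    finally show ?thesis .
  qed
  ultimately show ?thesis unfolding of_bianchi_type_iff[OF assms(1)] by auto
qed

text \<open>The vectors \<open>y\<close> and \<open>z\<close> span an abelian ideal on which
  \<open>[_, x]\<close> is triangular with eigenvalues 1 and \<open>- \<gamma>\<close>. Distinct
  eigenvalues give III or VI; the double eigenvalue 1 gives V when the action is scalar and IV when
  it is a Jordan block.\<close>

lemma of_bianchi_type_semidirect:
  assumes "DIM('a) = 3" and xyz: "lin_indep3 x y z"
    and xy: "br x y = - y" and xz: "br x z = \<beta> *\<^sub>R y + \<gamma> *\<^sub>R z" and yz: "br y z = 0"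
  shows "of_bianchi_type br Bianchi_III \<or> of_bianchi_type br Bianchi_IV \<or> of_bianchi_type br Bianchi_V
    \<or> (\<exists>h. h \<noteq> 0 \<and> of_bianchi_type br (Bianchi_VI h))"
proof -
  have yx: "br y x = y" and zx: "br z x = - (\<beta> *\<^sub>R y + \<gamma> *\<^sub>R z)"
    using xy xz br_anti[of y x] br_anti[of z x] by simp_all
  have indep: "lin_indep3 y (s *\<^sub>R z + t *\<^sub>R y) x" if "s \<noteq> 0" for s t
    unfolding lin_indep3_def
  proof (intro allI impI)
    fix a b c
    assume "a *\<^sub>R y + b *\<^sub>R (s *\<^sub>R z + t *\<^sub>R y) + c *\<^sub>R x = 0"
    then have "c *\<^sub>R x + (a + b * t) *\<^sub>R y + (b * s) *\<^sub>R z = 0" by (simp add: algebra_simps)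
    from lin_indep3D[OF xyz this] that show "a = 0 \<and> b = 0 \<and> c = 0" by auto
  qed
  consider "\<gamma> \<noteq> - 1" | "\<gamma> = - 1" "\<beta> = 0" | "\<gamma> = - 1" "\<beta> \<noteq> 0" by blast
  then show ?thesis
  proof cases
    case 1
    \<comment> \<open>Chosen so that \<open>z + t y\<close> is an eigenvector of
      \<open>[_, x]\<close> for \<open>- \<gamma>\<close>.\<close>
    define t where "t = \<beta> / (1 + \<gamma>)"
    have t: "t - \<beta> = - \<gamma> * t" using 1 by (simp add: t_def field_simps)
    define u where "u = 1 *\<^sub>R z + t *\<^sub>R y"
    have u: "lin_indep3 y u x" unfolding u_def by (rule indep) simp
    have "br u x = (- \<gamma>) *\<^sub>R z + (t - \<beta>) *\<^sub>R y"
      by (simp add: u_def br_linear zx yx algebra_simps)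
    then have ux: "br u x = (- \<gamma>) *\<^sub>R u" unfolding t by (simp add: u_def scaleR_add_right)
    have yu: "br y u = 0" by (simp add: u_def br_linear yz)
    show ?thesis
    proof (cases "\<gamma> = 0")
      case True
      then have "of_bianchi_type br Bianchi_III"
        unfolding of_bianchi_type_iff[OF assms(1)] using u ux yu yx by auto
      then show ?thesis ..
    next
      case False
      have "of_bianchi_type br (Bianchi_VI (- \<gamma>))"
        unfolding of_bianchi_type_iff[OF assms(1)] using u ux yu yx by auto
      then show ?thesis using False by (metis neg_equal_0_iff_equal)
    qed
  next
    case 2
    have "lin_indep3 y z x" using indep[of 1 0] by simp
    then have "of_bianchi_type br Bianchi_V"
      unfolding of_bianchi_type_iff[OF assms(1)] using 2 zx yz yx
      by (intro exI[of _ y] exI[of _ z] exI[of _ x]) simp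
    then show ?thesis by simp
  next
    case 3
    \<comment> \<open>The scaling turns the off-diagonal entry of the Jordan block into 1.\<close>
    define u where "u = (- 1 / \<beta>) *\<^sub>R z + 0 *\<^sub>R y"
    have u: "lin_indep3 y u x" unfolding u_def by (rule indep) (use 3 in simp)
    have "br u x = y + u" "br y u = 0"
      using 3 by (simp_all add: u_def br_linear zx yz algebra_simps)
    then have "of_bianchi_type br Bianchi_IV"
      unfolding of_bianchi_type_iff[OF assms(1)] using u yx by auto
    then show ?thesis by simp
  qed
qed

lemma bianchi_type_of_ad_eigenpair:
  assumes "DIM('a) = 3" and "ad_eigenpair br"
  shows "of_bianchi_type br Bianchi_III \<or> of_bianchi_type br Bianchi_IV \<or> of_bianchi_type br Bianchi_V
    \<or> (\<exists>h. h \<noteq> 0 \<and> of_bianchi_type br (Bianchi_VI h)) \<or> of_bianchi_type br Bianchi_VIII"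
proof -
  obtain x' y c where c: "c \<noteq> 0" and y: "y \<noteq> 0" "br x' y = c *\<^sub>R y"
    using assms(2) by (auto simp: ad_eigenpair_def)
  \<comment> \<open>Rescaled to eigenvalue -1, so that \<open>[y, x] = y\<close> matches the normal
    form \<open>[e1, e3] = e1\<close>.\<close>
  define x where "x = (- 1 / c) *\<^sub>R x'"
  have xy: "br x y = - y" using c by (simp add: x_def br_linear y(2))
  then have yx: "br y x = y" using br_anti[of y x] by simp
  have "x \<noteq> 0" using y(1) xy by (auto simp: br_linear)
  have "a = 0 \<and> b = 0" if e: "a *\<^sub>R x + b *\<^sub>R y = 0" for a b
  proof -
    have "b *\<^sub>R y = - br x (a *\<^sub>R x + b *\<^sub>R y)" by (simp add: br_linear xy)
    then have "b = 0" using y(1) by (simp add: e br_linear)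
    then show ?thesis using e \<open>x \<noteq> 0\<close> by simp
  qed
  then obtain z where xyz: "lin_indep3 x y z" by (rule lin_indep3_extend[OF assms(1)])
  obtain \<alpha> \<beta> \<gamma> where xz: "br x z = \<alpha> *\<^sub>R x + \<beta> *\<^sub>R y + \<gamma> *\<^sub>R z"
    by (rule lin_indep3_coords[OF assms(1) xyz])
  obtain \<delta> \<epsilon> \<phi> where yz: "br y z = \<delta> *\<^sub>R x + \<epsilon> *\<^sub>R y + \<phi> *\<^sub>R z"
    by (rule lin_indep3_coords[OF assms(1) xyz])
  note J = jacobi_constraints[OF xyz xy xz yz]
  have indep: "lin_indep3 x y (z + s *\<^sub>R x + t *\<^sub>R y)" for s t
    unfolding lin_indep3_def
  proof (intro allI impI)
    fix a b c
    assume "a *\<^sub>R x + b *\<^sub>R y + c *\<^sub>R (z + s *\<^sub>R x + t *\<^sub>R y) = 0"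
    then have "(a + c * s) *\<^sub>R x + (b + c * t) *\<^sub>R y + c *\<^sub>R z = 0" by (simp add: algebra_simps)
    from lin_indep3D[OF xyz this] show "a = 0 \<and> b = 0 \<and> c = 0" by auto
  qed
  show ?thesis
  proof (cases "\<delta> = 0")
    case False
    \<comment> \<open>Here \<open>\<gamma> = 1\<close> and \<open>\<alpha> = - \<epsilon>\<close>.
      The shift makes \<open>w\<close> an eigenvector of ad_x for 1 and cancels the \<open>y\<close>
      component of \<open>[y, w]\<close>.\<close>
    define w where "w = z + (- \<epsilon>) *\<^sub>R x + (\<beta> / 2) *\<^sub>R y"
    have "br x w = (- \<epsilon>) *\<^sub>R x + (\<beta> *\<^sub>R y - (\<beta> / 2) *\<^sub>R y) + z"
      using False J by (simp add: w_def br_linear xz xy)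
    also have "\<beta> *\<^sub>R y - (\<beta> / 2) *\<^sub>R y = (\<beta> / 2) *\<^sub>R y"
      by (simp flip: scaleR_diff_left)
    finally have "br x w = w" by (simp add: w_def)
    moreover have "br y w = \<delta> *\<^sub>R x" using J by (simp add: w_def br_linear yz yx)
    moreover have "lin_indep3 x y w" unfolding w_def by (rule indep)
    ultimately show ?thesis using of_bianchi_type_VIII[OF assms(1) _ False xy] by blast
  next
    case True
    \<comment> \<open>Subtracting \<open>\<epsilon> x\<close> makes \<open>w\<close> commute with
      \<open>y\<close>; by \<open>\<alpha> = - \<gamma> * \<epsilon>\<close> it also removes the
      \<open>x\<close> component of \<open>[x, w]\<close>.\<close>
    define w where "w = z + (- \<epsilon>) *\<^sub>R x + 0 *\<^sub>R y"
    have "br x w = \<beta> *\<^sub>R y + \<gamma> *\<^sub>R w"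
      using J by (simp add: w_def br_linear xz algebra_simps)
    moreover have "br y w = 0" using J True by (simp add: w_def br_linear yz yx)
    moreover have "lin_indep3 x y w" unfolding w_def by (rule indep)
    ultimately show ?thesis using of_bianchi_type_semidirect[OF assms(1) _ xy] by blast
  qed
qed

section \<open>Without an eigenpair: the types I, II, IX, and VII with |h| < 2\<close>

lemma of_bianchi_type_nilpotent:
  assumes "DIM('a) = 3" and no: "\<not> ad_eigenpair br" and nil: "\<And>x w. br x (br x (br x w)) = 0"
  shows "of_bianchi_type br Bianchi_I \<or> of_bianchi_type br Bianchi_II"
proof -
  \<comment> \<open>Otherwise \<open>w\<close>, \<open>u\<close>, \<open>v\<close> form a Jordan
    chain of ad_x and a basis. As ad_x kills \<open>x\<close>, the vector \<open>x\<close> is a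
    multiple of \<open>v\<close>, and then \<open>[v, u]\<close> is a nonzero multiple of
    \<open>v\<close>: an eigenpair.\<close>
  have nil2: "br x (br x w) = 0" for x w
  proof (rule ccontr)
    assume n: "br x (br x w) \<noteq> 0"
    define u v where "u = br x w" and "v = br x u"
    have v: "v \<noteq> 0" "br x v = 0" "br x u = v" "br x w = u" using n nil by (simp_all add: u_def v_def)
    have wuv: "lin_indep3 w u v"
      unfolding lin_indep3_def
    proof (intro allI impI)
      fix a b c
      assume e: "a *\<^sub>R w + b *\<^sub>R u + c *\<^sub>R v = 0"
      have "a *\<^sub>R v = br x (br x (a *\<^sub>R w + b *\<^sub>R u + c *\<^sub>R v))" by (simp add: br_linear v)
      then have a: "a = 0" using v(1) by (simp add: e br_linear)
      have "b *\<^sub>R v = br x (a *\<^sub>R w + b *\<^sub>R u + c *\<^sub>R v)" by (simp add: br_linear v a)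
      then have "b = 0" using v(1) by (simp add: e br_linear)
      with a e v(1) show "a = 0 \<and> b = 0 \<and> c = 0" by simp
    qed
    obtain a b c where x: "x = a *\<^sub>R w + b *\<^sub>R u + c *\<^sub>R v"
      by (rule lin_indep3_coords[OF assms(1) wuv])
    have "a *\<^sub>R u + b *\<^sub>R v = br x (a *\<^sub>R w + b *\<^sub>R u + c *\<^sub>R v)" by (simp add: br_linear v)
    also have "\<dots> = 0" by (simp add: br_self flip: x)
    finally have "a = 0" "b = 0" using lin_indep3D[OF wuv, of 0 a b] by auto
    then have xv: "x = c *\<^sub>R v" using x by simp
    have "c \<noteq> 0" using xv v n by (auto simp: br_linear)
    have "c *\<^sub>R br v u = v" using v(3) xv by (metis br_linear(3))
    then have "br v u = (1 / c) *\<^sub>R v" using \<open>c \<noteq> 0\<close>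
      by (metis divide_self scaleR_one scaleR_scaleR times_divide_eq_left mult_1)
    with \<open>c \<noteq> 0\<close> v(1) show False using no ad_eigenpairI by simp
  qed
  show ?thesis
  proof (cases "\<forall>x w. br x w = 0")
    case True
    have "card (Basis :: 'a set) = 3" using assms(1) by simp
    then obtain e1 e2 e3 :: 'a where e: "Basis = {e1, e2, e3}" "distinct [e1, e2, e3]"
      by (auto simp: card_3_iff)
    then have "lin_indep3 e1 e2 e3"
      using independent_Basis[where ?'a = 'a] by (simp add: lin_indep3_iff)
    then have "of_bianchi_type br Bianchi_I"
      unfolding of_bianchi_type_iff[OF assms(1)] using True by auto
    then show ?thesis ..
  next
    case False
    then obtain x w where n: "br x w \<noteq> 0" by blast
    \<comment> \<open>By \<open>nil2\<close> this commutes with both \<open>x\<close> and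
      \<open>w\<close>, so the algebra is the Heisenberg algebra with centre spanned by
      \<open>z\<close>.\<close>
    define z where "z = br x w"
    have z: "z \<noteq> 0" "br x z = 0" "br x w = z" "br w x = - z"
      using n nil2 br_anti[of w x] by (simp_all add: z_def)
    have wz: "br w z = 0" using nil2[of w x] z(4) by (simp add: br_linear)
    have zx: "br z x = 0" "br z w = 0" using z(2) wz br_anti[of z x] br_anti[of z w] by simp_all
    have "lin_indep3 z x w"
      unfolding lin_indep3_def
    proof (intro allI impI)
      fix a b c
      assume e: "a *\<^sub>R z + b *\<^sub>R x + c *\<^sub>R w = 0"
      have "c *\<^sub>R z = br x (a *\<^sub>R z + b *\<^sub>R x + c *\<^sub>R w)" by (simp add: br_linear z)
      then have c: "c = 0" using z(1) by (simp add: e br_linear)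
      have "b *\<^sub>R z = - br w (a *\<^sub>R z + b *\<^sub>R x + c *\<^sub>R w)" by (simp add: br_linear z wz)
      then have "b = 0" using z(1) by (simp add: e br_linear)
      with c e z(1) show "a = 0 \<and> b = 0 \<and> c = 0" by simp
    qed
    then have "of_bianchi_type br Bianchi_II"
      unfolding of_bianchi_type_iff[OF assms(1)] using z zx by auto
    then show ?thesis ..
  qed
qed

lemma not_ad_eigenpairD:
  assumes "\<not> ad_eigenpair br" "br x y = c *\<^sub>R y"
  shows "br x y = 0"
  using assms by (auto simp: ad_eigenpair_def)

text \<open>On the plane spanned by \<open>br x w\<close> and its image, ad_x can have no real
  eigenvalue. Rescaling \<open>x\<close> brings its determinant there to 1, and the negative
  discriminant becomes the bound on the trace.\<close>

lemma elliptic_basis: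
  assumes "DIM('a) = 3" and no: "\<not> ad_eigenpair br" and n: "br x (br x (br x w)) \<noteq> 0"
  obtains x u v T where "lin_indep3 x u v" "br x u = v" "br x v = - u + T *\<^sub>R v" "\<bar>T\<bar> < 2"
proof -
  \<comment> \<open>Applying ad_x to a linear relation removes \<open>x\<close>; if \<open>c\<close>
    were nonzero, \<open>br x p\<close> would be an eigenvector, which the absence of eigenpairs
    forces into the kernel.\<close>
  have indep: "lin_indep3 x p (br x p)" if "br x (br x p) \<noteq> 0" for p
    unfolding lin_indep3_def
  proof (intro allI impI)
    fix a b c
    assume e: "a *\<^sub>R x + b *\<^sub>R p + c *\<^sub>R br x p = 0"
    have "b *\<^sub>R br x p + c *\<^sub>R br x (br x p) = br x (a *\<^sub>R x + b *\<^sub>R p + c *\<^sub>R br x p)"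
      by (simp add: br_linear)
    then have e2: "b *\<^sub>R br x p + c *\<^sub>R br x (br x p) = 0" by (simp add: e br_linear)
    have c: "c = 0"
    proof (rule ccontr)
      assume "c \<noteq> 0"
      have "c *\<^sub>R br x (br x p) = (- b) *\<^sub>R br x p" using e2 by (simp add: eq_neg_iff_add_eq_0 add.commute)
      then have "(1 / c) *\<^sub>R (c *\<^sub>R br x (br x p)) = (1 / c) *\<^sub>R ((- b) *\<^sub>R br x p)" by simp
      then have "br x (br x p) = (- b / c) *\<^sub>R br x p" using \<open>c \<noteq> 0\<close> by simp
      then have "br x (br x p) = 0" by (rule not_ad_eigenpairD[OF no])
      with that show False ..
    qed
    have "br x p \<noteq> 0" using that by (auto simp: br_linear)
    with c e2 have b: "b = 0" by simp
    have "x \<noteq> 0" using that by (auto simp: br_linear)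
    with b c e show "a = 0 \<and> b = 0 \<and> c = 0" by simp
  qed
  define u v where "u = br x w" and "v = br x u"
  have "br x (br x w) \<noteq> 0" using n by (auto simp: br_linear)
  then have "lin_indep3 x w u" unfolding u_def by (rule indep)
  then obtain A B T where "v = A *\<^sub>R x + B *\<^sub>R w + T *\<^sub>R u"
    by (rule lin_indep3_coords[OF assms(1)])
  then have xv: "br x v = B *\<^sub>R u + T *\<^sub>R v" by (simp add: br_linear u_def v_def)
  have xuv: "lin_indep3 x u v" unfolding v_def by (rule indep) (use n in \<open>simp add: u_def\<close>)
  have xv0: "br x v \<noteq> 0" using n by (simp add: u_def v_def)
  \<comment> \<open>A real root \<open>l\<close> of t^2 - T t - B would give the eigenvector
    \<open>y\<close>. Hence \<open>l = 0\<close> and \<open>B = 0\<close>, so \<open>v\<close> is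
    itself an eigenvector and lies in the kernel, a contradiction.\<close>
  have disc: "T\<^sup>2 + 4 * B < 0"
  proof (rule ccontr)
    assume "\<not> T\<^sup>2 + 4 * B < 0"
    then have s: "(sqrt (T\<^sup>2 + 4 * B))\<^sup>2 = T\<^sup>2 + 4 * B" by simp
    define l where "l = (T + sqrt (T\<^sup>2 + 4 * B)) / 2"
    have root: "B = l * (l - T)"
      using s unfolding l_def by (simp add: power2_eq_square field_simps)
    define y where "y = v + (l - T) *\<^sub>R u"
    have "y \<noteq> 0" using lin_indep3D(3)[OF xuv, of 0 "l - T" 1] by (auto simp: y_def add.commute)
    have "br x y = l *\<^sub>R y"
      by (simp add: y_def br_linear xv root v_def[symmetric] algebra_simps)
    then have "l *\<^sub>R y = 0" using not_ad_eigenpairD[OF no] by metis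
    with \<open>y \<noteq> 0\<close> have "B = 0" using root by simp
    then have "br x v = T *\<^sub>R v" using xv by simp
    then have "br x v = 0" by (rule not_ad_eigenpairD[OF no])
    with xv0 show False ..
  qed
  then have B: "B < 0" by (smt (verit) zero_le_power2)
  \<comment> \<open>The determinant of ad_x on the plane of \<open>u\<close> and \<open>v\<close> is
    \<open>- B\<close>; dividing \<open>x\<close> by its square root makes it 1.\<close>
  define r where "r = sqrt (- B)"
  have r: "r > 0" "r * r = - B" using B by (simp_all add: r_def)
  show ?thesis
  proof (rule that[of "(1 / r) *\<^sub>R x" u "(1 / r) *\<^sub>R v" "T / r"])
    show "lin_indep3 ((1 / r) *\<^sub>R x) u ((1 / r) *\<^sub>R v)"
      unfolding lin_indep3_def using lin_indep3D[OF xuv] r(1)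
      by (metis divide_eq_0_iff less_irrefl mult.right_neutral scaleR_scaleR times_divide_eq_right)
    show "br ((1 / r) *\<^sub>R x) u = (1 / r) *\<^sub>R v" by (simp add: br_linear v_def)
    have "B / (r * r) = - 1" using r B by simp
    then show "br ((1 / r) *\<^sub>R x) ((1 / r) *\<^sub>R v) = - u + (T / r) *\<^sub>R (1 / r) *\<^sub>R v"
      by (simp add: br_linear xv scaleR_add_right)
    have "T\<^sup>2 < 4 * (r * r)" using disc r(2) by simp
    then have "(T / r / 2)\<^sup>2 < 1" using r(1) by (simp add: power2_eq_square field_simps)
    then show "\<bar>T / r\<bar> < 2" using abs_square_less_1[of "T / r / 2"] by simp
  qed
qed

lemma bianchi_type_of_no_ad_eigenpair:
  assumes "DIM('a) = 3" and no: "\<not> ad_eigenpair br"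
  shows "of_bianchi_type br Bianchi_I \<or> of_bianchi_type br Bianchi_II \<or> of_bianchi_type br Bianchi_IX
    \<or> (\<exists>h. \<bar>h\<bar> < 2 \<and> of_bianchi_type br (Bianchi_VII h))"
proof (cases "\<forall>x w. br x (br x (br x w)) = 0")
  case True
  then show ?thesis using of_bianchi_type_nilpotent[OF assms] by blast
next
  case False
  then obtain x w where "br x (br x (br x w)) \<noteq> 0" by blast
  then obtain x u v T where xuv: "lin_indep3 x u v"
    and xu: "br x u = v" and xv: "br x v = - u + T *\<^sub>R v" and T: "\<bar>T\<bar> < 2"
    by (rule elliptic_basis[OF assms])
  have ux: "br u x = - v" and vx: "br v x = u - T *\<^sub>R v"
    using xu xv br_anti[of u x] br_anti[of v x] by simp_all
  \<comment> \<open>By the derivation rule ad_x acts on \<open>[u, v]\<close> by its trace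
    \<open>T\<close> on the plane of \<open>u\<close> and \<open>v\<close>.\<close>
  have uv_eigen: "br x (br u v) = T *\<^sub>R br u v"
    using br_derivation[of x u v] br_anti[of u u] by (simp add: xu xv br_linear)
  then have xuv0: "br x (br u v) = 0" by (rule not_ad_eigenpairD[OF no])
  show ?thesis
  proof (cases "br u v = 0")
    case True
    have "lin_indep3 u v (- x)"
      unfolding lin_indep3_def
    proof (intro allI impI)
      fix a b c
      assume "a *\<^sub>R u + b *\<^sub>R v + c *\<^sub>R (- x) = 0"
      then have "(- c) *\<^sub>R x + a *\<^sub>R u + b *\<^sub>R v = 0" by (simp add: algebra_simps)
      from lin_indep3D[OF xuv this] show "a = 0 \<and> b = 0 \<and> c = 0" by auto
    qed
    moreover have "br u (- x) = v" "br v (- x) = - u + T *\<^sub>R v"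
      by (simp_all add: br_linear ux vx)
    ultimately have "of_bianchi_type br (Bianchi_VII T)"
      unfolding of_bianchi_type_iff[OF assms(1)] using True by auto
    then show ?thesis using T by blast
  next
    case False
    then have "T = 0" using uv_eigen xuv0 by simp
    obtain a b c where uv: "br u v = a *\<^sub>R x + b *\<^sub>R u + c *\<^sub>R v"
      by (rule lin_indep3_coords[OF assms(1) xuv])
    \<comment> \<open>With \<open>T = 0\<close>, ad_x rotates the plane of \<open>u\<close> and
      \<open>v\<close>, so its kernel is the line through \<open>x\<close>, which therefore contains
      \<open>[u, v]\<close>.\<close>
    have "0 *\<^sub>R x + (- c) *\<^sub>R u + b *\<^sub>R v = br x (br u v)"
      by (simp add: uv br_linear xu xv \<open>T = 0\<close>)
    then have "b = 0" "c = 0" using lin_indep3D[OF xuv, of 0 "- c" b] xuv0 by auto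
    then have uv: "br u v = a *\<^sub>R x" using uv by simp
    with False have "a \<noteq> 0" by auto
    \<comment> \<open>Scaling \<open>u\<close> and \<open>v\<close> by \<open>s\<close> reduces the
      coefficient \<open>a\<close> to its sign.\<close>
    define s where "s = 1 / sqrt \<bar>a\<bar>"
    have s: "s \<noteq> 0" "s * s * a = sgn a" using \<open>a \<noteq> 0\<close> by (simp_all add: s_def sgn_if)
    have uv': "br (s *\<^sub>R u) (s *\<^sub>R v) = sgn a *\<^sub>R x"
      by (simp add: br_linear uv flip: s(2) mult.assoc)
    show ?thesis
    proof (cases "a > 0")
      case True
      have "lin_indep3 (s *\<^sub>R u) (s *\<^sub>R v) x"
        unfolding lin_indep3_def
      proof (intro allI impI)
        fix a b c
        assume "a *\<^sub>R s *\<^sub>R u + b *\<^sub>R s *\<^sub>R v + c *\<^sub>R x = 0"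
        then have "c *\<^sub>R x + (a * s) *\<^sub>R u + (b * s) *\<^sub>R v = 0" by (simp add: algebra_simps)
        from lin_indep3D[OF xuv this] show "a = 0 \<and> b = 0 \<and> c = 0" using s(1) by auto
      qed
      moreover have "br (s *\<^sub>R u) x = - (s *\<^sub>R v)" "br (s *\<^sub>R v) x = s *\<^sub>R u"
        by (simp_all add: br_linear ux vx \<open>T = 0\<close>)
      ultimately have "of_bianchi_type br Bianchi_IX"
        unfolding of_bianchi_type_iff[OF assms(1)] using uv' True
        by (intro exI[of _ "s *\<^sub>R u"] exI[of _ "s *\<^sub>R v"] exI[of _ x]) simp
      then show ?thesis by simp
    next
      case False
      \<comment> \<open>For negative \<open>a\<close> the algebra is so(2,1), and this
        \<open>y\<close> is fixed by the action of \<open>s u\<close>, so it would have to vanish,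
        against independence.\<close>
      define y where "y = x - s *\<^sub>R v"
      have "br (s *\<^sub>R u) y = s *\<^sub>R br u x - br (s *\<^sub>R u) (s *\<^sub>R v)"
        by (simp add: y_def br_linear)
      also have "\<dots> = y" unfolding uv' using False \<open>a \<noteq> 0\<close> by (simp add: y_def ux)
      finally have "br (s *\<^sub>R u) y = 1 *\<^sub>R y" by simp
      then have "y = 0" using not_ad_eigenpairD[OF no] by (metis scaleR_one)
      then show ?thesis using lin_indep3D(1)[OF xuv, of 1 0 "- s"] by (simp add: y_def)
    qed
  qed
qed

end

theorem proposition6p1:
  fixes br :: "'a::euclidean_space \<Rightarrow> 'a \<Rightarrow> 'a"
  assumes "real_lie_algebra br" and "DIM('a) = 3"
  shows
    "((\<exists>H. smooth H \<and> homogeneous H \<and> (\<exists>\<mu>. nontrivial_conformal_relative_equilibrium br H \<mu>))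
        \<longleftrightarrow> of_bianchi_type br Bianchi_III \<or> of_bianchi_type br Bianchi_IV
          \<or> of_bianchi_type br Bianchi_V \<or> of_bianchi_type br (Bianchi_VI (- 1))
          \<or> (\<exists>h. h \<noteq> 0 \<and> h \<noteq> - 1 \<and> of_bianchi_type br (Bianchi_VI h))
          \<or> (\<exists>h. \<bar>h\<bar> \<ge> 2 \<and> of_bianchi_type br (Bianchi_VII h))
          \<or> of_bianchi_type br Bianchi_VIII)
     \<and> ((\<nexists>H. smooth H \<and> homogeneous H \<and> (\<exists>\<mu>. nontrivial_conformal_relative_equilibrium br H \<mu>))
        \<longleftrightarrow> of_bianchi_type br Bianchi_I \<or> of_bianchi_type br Bianchi_II
          \<or> of_bianchi_type br (Bianchi_VII 0) \<or> of_bianchi_type br Bianchi_IX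
          \<or> (\<exists>h. 0 < \<bar>h\<bar> \<and> \<bar>h\<bar> < 2 \<and> of_bianchi_type br (Bianchi_VII h)))"
proof -
  interpret real_lie_algebra br by fact
  note dim = \<open>DIM('a) = 3\<close>
  \<comment> \<open>Type VII with |h| >= 2 has real eigenvalues and is isomorphic to IV or to some
    VI, so the forward direction always ends in one of the other types.\<close>
  have pos: "ad_eigenpair br \<longleftrightarrow> of_bianchi_type br Bianchi_III \<or> of_bianchi_type br Bianchi_IV
      \<or> of_bianchi_type br Bianchi_V \<or> of_bianchi_type br (Bianchi_VI (- 1))
      \<or> (\<exists>h. h \<noteq> 0 \<and> h \<noteq> - 1 \<and> of_bianchi_type br (Bianchi_VI h))
      \<or> (\<exists>h. \<bar>h\<bar> \<ge> 2 \<and> of_bianchi_type br (Bianchi_VII h))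
      \<or> of_bianchi_type br Bianchi_VIII"
    using bianchi_type_of_ad_eigenpair[OF dim] ad_eigenpair_first_bracket[OF dim]
      ad_eigenpair_VII[OF dim] ad_eigenpair_VIII[OF dim] by blast
  have neg: "\<not> ad_eigenpair br \<longleftrightarrow> of_bianchi_type br Bianchi_I \<or> of_bianchi_type br Bianchi_II
      \<or> of_bianchi_type br (Bianchi_VII 0) \<or> of_bianchi_type br Bianchi_IX
      \<or> (\<exists>h. 0 < \<bar>h\<bar> \<and> \<bar>h\<bar> < 2 \<and> of_bianchi_type br (Bianchi_VII h))"
    (is "_ \<longleftrightarrow> ?R")
  proof
    assume "\<not> ad_eigenpair br"
    then show ?R
      using bianchi_type_of_no_ad_eigenpair[OF dim] by (metis zero_less_abs_iff)
  next
    assume ?R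
    then show "\<not> ad_eigenpair br"
      using not_ad_eigenpair_I[OF dim] not_ad_eigenpair_II[OF dim] not_ad_eigenpair_IX[OF dim]
        not_ad_eigenpair_VII[OF dim] by (metis abs_zero zero_less_numeral)
  qed
  show ?thesis
    unfolding equilibrium_iff_ad_eigenpair using pos neg by (rule conjI)
qed

end
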